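(* If $\mathscr{B}\subset\mathbb{N}$ has light tails and $F,M\subset\mathbb{N}$ are finite sets such that $F\subset\mathcal{F}_{\mathscr{B}}$, $M\subset\mathcal{M}_{\mathscr{B}}$, then the density of the set of $n\in\mathbb{N}$ such that $F+n\subset\mathcal{F}_{\mathscr{B}}$ and $M+n\subset\mathcal{M}_{\mathscr{B}}$ is positive.
   Context: $\mathbb{N}=\{1,2,\dots\}$. For $\mathscr{B}\subset\mathbb{N}$ let $\mathcal{M}_{\mathscr{B}}:=\bigcup_{b\in\mathscr{B}}b\mathbb{Z}$ and $\mathcal{F}_{\mathscr{B}}:=\mathbb{Z}\setminus\mathcal{M}_{\mathscr{B}}$. The upper density of $A\subset\mathbb{Z}$ is $\overline{d}(A)=\limsup_{N\to\infty}\frac1N|A\cap[1,N]|$; the density is $d(A)=\lim_{N\to\infty}\frac1N|A\cap[1,N]|$ when the limit exists. $\mathscr{B}$ has light tails if $\lim_{K\to\infty}\overline{d}\left(\bigcup_{b\in\mathscr{B},\,b>K}b\mathbb{Z}\right)=0$. *)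

theory Defs
  imports "HOL-Analysis.Analysis"
begin

text \<open>Subsets of the positive integers are represented as sets of integers contained in
  \<open>pos_ints\<close>, so that they can be compared with subsets of the integers without coercions.\<close>

definition pos_ints :: "int set" where
  "pos_ints = {n. 1 \<le> n}"

definition multiples_of :: "int set \<Rightarrow> int set" where
  "multiples_of B = (\<Union>b\<in>B. range (\<lambda>k. b * k))"

definition free_of :: "int set \<Rightarrow> int set" where
  "free_of B = UNIV - multiples_of B"

definition translate :: "int set \<Rightarrow> int \<Rightarrow> int set" where
  "translate A n = (\<lambda>a. a + n) ` A"

definition upper_density :: "int set \<Rightarrow> ereal" where
  "upper_density A = limsup (\<lambda>N. ereal (real (card (A \<inter> {1..int N})) / real N))"

text \<open>\<open>has_density A d\<close> asserts both that the density exists and that it equals \<open>d\<close>.\<close>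

definition has_density :: "int set \<Rightarrow> real \<Rightarrow> bool" where
  "has_density A d \<longleftrightarrow> (\<lambda>N. real (card (A \<inter> {1..int N})) / real N) \<longlonglongrightarrow> d"

definition light_tails :: "int set \<Rightarrow> bool" where
  "light_tails B \<longleftrightarrow>
     (\<lambda>K::nat. upper_density (multiples_of {b \<in> B. b > int K})) \<longlonglongrightarrow> 0"

end

theory Submission
  imports Defs "HOL-Real_Asymp.Real_Asymp"
begin

text \<open>
  Let \<open>S\<close> be the set of all \<open>n\<close> with \<open>F + n\<close> free of \<open>B\<close> and \<open>M + n\<close> contained in the multiples
  of \<open>B\<close>. That \<open>S\<close> has a density, and that this density is positive, are two separate arguments.

  \<^emph>\<open>Existence.\<close> Replacing \<open>B\<close> by its finite part up to \<open>K\<close> turns \<open>S\<close> into a periodic set, which has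
  a density. The two sets differ only at those \<open>n\<close> for which some \<open>n + h\<close> with \<open>h \<in> F \<union> M\<close> is a
  multiple of an element of \<open>B\<close> beyond \<open>K\<close>, and by light tails the upper density of these \<open>n\<close>
  tends to \<open>0\<close> as \<open>K\<close> grows. So \<open>S\<close> is a limit, in upper density, of sets having a density, and it
  has a density itself (\<open>has_density_approx\<close>, \<open>has_density_pattern\<close>).

  \<^emph>\<open>Positivity.\<close> Only \<open>n = L m\<close> are considered, where \<open>L\<close> is the product of all elements of \<open>F\<close> and
  all elements of \<open>B\<close> up to \<open>K\<close>. For such \<open>n\<close>, no \<open>b \<le> K\<close> in \<open>B\<close> divides any \<open>f + n\<close>, since \<open>b\<close> divides
  \<open>L\<close> but not \<open>f\<close>; and \<open>M + n\<close> consists of multiples as soon as \<open>K\<close> bounds \<open>M\<close>. Only the tail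
  beyond \<open>K\<close> can spoil \<open>m\<close>. The difficulty is that \<open>L\<close> depends on \<open>K\<close> and may grow much faster than
  the density of the multiples of the tail decays, so the spoiled \<open>m\<close> must be bounded independently
  of \<open>L\<close>. This is achieved by writing \<open>f + L m = f (1 + q m)\<close> with \<open>q = L / f\<close>. A number \<open>b\<close> divides
  this exactly if \<open>b / gcd b f\<close> divides \<open>1 + q m\<close>; hence \<open>b / gcd b f\<close> is coprime to \<open>q\<close>, and multiples
  of moduli coprime to \<open>q\<close> are no more frequent in a progression modulo \<open>q\<close> than among all integers.
  So the spoiled \<open>m\<close> belonging to \<open>f\<close> have upper density at most \<open>f\<close> times that of the multiples of
  the tail (\<open>upper_density_multiples_in_progression\<close>), and for large \<open>K\<close> these bounds add up to less
  than \<open>1/2\<close> over \<open>f \<in> F\<close>.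
\<close>

section \<open>Upper density\<close>

abbreviation ratio :: "int set \<Rightarrow> nat \<Rightarrow> real" where
  "ratio A N \<equiv> real (card (A \<inter> {1..int N})) / real N"

lemma card_initial_le: "card (A \<inter> {1..int N}) \<le> N"
proof -
  have "card (A \<inter> {1..int N}) \<le> card {1..int N}"
    by (intro card_mono) auto
  then show ?thesis by simp
qed

lemma ratio_le_1: "ratio A N \<le> 1"
  using card_initial_le[of A N] by (auto simp: divide_le_eq)

lemma ratio_mono:
  assumes "A \<inter> pos_ints \<subseteq> A'"
  shows "ratio A N \<le> ratio A' N"
  using assms by (intro divide_right_mono of_nat_mono card_mono) (auto simp: pos_ints_def)

lemma ratio_Un: "ratio (A \<union> A') N \<le> ratio A N + ratio A' N"
proof -
  have "card ((A \<union> A') \<inter> {1..int N}) \<le> card (A \<inter> {1..int N}) + card (A' \<inter> {1..int N})"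
    unfolding Int_Un_distrib2 by (rule card_Un_le)
  then show ?thesis
    by (metis add_divide_distrib divide_right_mono of_nat_0_le_iff of_nat_add of_nat_mono)
qed

lemma upper_density_nonneg: "0 \<le> upper_density A"
  unfolding upper_density_def
  by (intro le_Limsup) auto

lemma upper_density_le_1: "upper_density A \<le> 1"
  unfolding upper_density_def
  by (intro Limsup_bounded) (auto simp: ratio_le_1 simp flip: one_ereal_def)

lemma upper_density_real:
  obtains u where "upper_density A = ereal u" "0 \<le> u"
  using upper_density_nonneg[of A] upper_density_le_1[of A]
  by (cases "upper_density A") auto

lemma upper_density_mono:
  assumes "A \<inter> pos_ints \<subseteq> A'"
  shows "upper_density A \<le> upper_density A'"
  unfolding upper_density_def
  by (intro Limsup_mono always_eventually allI) (use ratio_mono[OF assms] in simp)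

lemma upper_density_Un: "upper_density (A \<union> A') \<le> upper_density A + upper_density A'"
proof -
  have "upper_density (A \<union> A') \<le> limsup (\<lambda>N. ereal (ratio A N) + ereal (ratio A' N))"
    unfolding upper_density_def
    by (intro Limsup_mono always_eventually allI) (use ratio_Un[of A A'] in simp)
  also have "\<dots> \<le> upper_density A + upper_density A'"
    unfolding upper_density_def by (rule ereal_limsup_add_mono)
  finally show ?thesis .
qed

lemma upper_density_UN:
  assumes "finite I"
  shows "upper_density (\<Union>i\<in>I. A i) \<le> (\<Sum>i\<in>I. upper_density (A i))"
  using assms
proof (induction I)
  case empty
  show ?case by (simp add: upper_density_def Limsup_const flip: zero_ereal_def)
next
  case (insert i I)
  have "upper_density (\<Union>j\<in>insert i I. A j) \<le> upper_density (A i) + upper_density (\<Union>j\<in>I. A j)"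
    using upper_density_Un[of "A i" "\<Union>j\<in>I. A j"] by simp
  also have "\<dots> \<le> upper_density (A i) + (\<Sum>j\<in>I. upper_density (A j))"
    by (intro add_left_mono insert.IH)
  finally show ?case using insert by simp
qed

lemma has_density_upper_density:
  assumes "has_density A d"
  shows "upper_density A = ereal d"
  unfolding upper_density_def
  using assms[unfolded has_density_def]
  by (intro lim_imp_Limsup) (auto intro: tendsto_ereal)

text \<open>The injection \<open>x \<mapsto> c x + r\<close> stretches the counting window by the factor \<open>c\<close>. This one comparison
  serves for translations (\<open>c = 1\<close>), for dilations (\<open>r = 0\<close>), and as a crude bound on progressions.\<close>

lemma upper_density_affine:
  assumes c: "1 \<le> c" and r: "0 \<le> r"
    and A: "\<And>x. x \<in> A \<Longrightarrow> 1 \<le> x \<Longrightarrow> c * x + r \<in> A'"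
  shows "upper_density A \<le> ereal (real_of_int c) * upper_density A'"
proof -
  obtain u where u: "upper_density A' = ereal u" "0 \<le> u"
    by (rule upper_density_real)
  have "upper_density A \<le> ereal (c * u) + ereal \<epsilon>" if \<epsilon>: "0 < \<epsilon>" for \<epsilon> :: real
  proof -
    define e where "e = u + \<epsilon> / (2 * c)"
    have ce: "c * e = c * u + \<epsilon> / 2" and e0: "0 \<le> e"
      using c \<epsilon> u by (simp_all add: e_def field_simps)
    have "upper_density A' < ereal e" using u c \<epsilon> by (simp add: e_def)
    then have "eventually (\<lambda>N. ratio A' N < e) sequentially"
      unfolding upper_density_def by (auto dest: Limsup_lessD)
    then obtain N0 where N0: "\<And>N. N \<ge> N0 \<Longrightarrow> ratio A' N < e"
      by (auto simp: eventually_sequentially)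
    have "(\<lambda>N. e * r / real N) \<longlonglongrightarrow> 0"
      by real_asymp
    then have "eventually (\<lambda>N. e * r / real N < \<epsilon> / 2) sequentially"
      using \<epsilon> by (intro order_tendstoD) auto
    then have "eventually (\<lambda>N. ereal (ratio A N) \<le> ereal (c * u + \<epsilon>)) sequentially"
      using eventually_ge_at_top[of "max N0 1"]
    proof eventually_elim
      case (elim N)
      define N' where "N' = nat (c * int N + r)"
      have N': "int N' = c * int N + r" using c r by (simp add: N'_def)
      have "int N \<le> int N'" unfolding N' using c r mult_right_mono[of 1 c "int N"] by simp
      then have le: "N \<le> N'" by simp
      have "card (A \<inter> {1..int N}) \<le> card (A' \<inter> {1..int N'})"
      proof (rule card_inj_on_le)
        show "inj_on (\<lambda>x. c * x + r) (A \<inter> {1..int N})"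
          using c by (auto simp: inj_on_def)
        have "1 \<le> c * x" if "1 \<le> x" for x :: int
          using c that mult_mono[of 1 c 1 x] by simp
        then show "(\<lambda>x. c * x + r) ` (A \<inter> {1..int N}) \<subseteq> A' \<inter> {1..int N'}"
          using A c r by (force simp: N')
      qed simp
      also have "real (card (A' \<inter> {1..int N'})) \<le> e * real N'"
        using N0[of N'] le elim by (auto simp: divide_less_eq)
      also have "real N' = c * real N + r"
        using N' by (metis of_int_add of_int_mult of_int_of_nat_eq)
      finally have "ratio A N \<le> e * (c * real N + r) / real N"
        by (simp add: divide_right_mono)
      also have "\<dots> = c * e + e * r / real N" using elim by (simp add: field_simps)
      also have "\<dots> \<le> c * u + \<epsilon>" using ce elim(1) by linarith
      finally show ?case by simp
    qed
    then have "upper_density A \<le> ereal (c * u + \<epsilon>)"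
      unfolding upper_density_def by (rule Limsup_bounded)
    then show ?thesis by simp
  qed
  then have "upper_density A \<le> ereal (c * u)"
    using ereal_le_epsilon2 by blast
  then show ?thesis using u by simp
qed

section \<open>Periodic sets\<close>

lemma has_density_periodic:
  fixes p :: nat
  assumes p: "0 < p" and per: "\<And>n. n + int p \<in> A \<longleftrightarrow> n \<in> A"
  shows "has_density A (ratio A p)"
proof -
  define f where "f N = card (A \<inter> {1..int N})" for N
  have step: "f (N + p) = f p + f N" for N
  proof -
    have "A \<inter> {1..int (N + p)} = (A \<inter> {1..int p}) \<union> (\<lambda>x. x + int p) ` (A \<inter> {1..int N})"
    proof (intro equalityI subsetI)
      fix x assume x: "x \<in> A \<inter> {1..int (N + p)}"
      show "x \<in> (A \<inter> {1..int p}) \<union> (\<lambda>x. x + int p) ` (A \<inter> {1..int N})"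
      proof (cases "x \<le> int p")
        case False
        then have "x - int p \<in> A \<inter> {1..int N}" using x per[of "x - int p"] by auto
        then show ?thesis by (metis UnI2 diff_add_cancel imageI)
      qed (use x in auto)
    qed (use per in auto)
    then have "f (N + p) = f p + card ((\<lambda>x. x + int p) ` (A \<inter> {1..int N}))"
      unfolding f_def by (subst card_Un_disjoint[symmetric]) auto
    also have "card ((\<lambda>x. x + int p) ` (A \<inter> {1..int N})) = f N"
      unfolding f_def by (intro card_image) auto
    finally show ?thesis .
  qed
  define c where "c = real (f p) / real p"
  have c: "0 \<le> c" "c \<le> 1" using ratio_le_1[of A p] by (simp_all add: c_def f_def)
  \<comment> \<open>By the previous step the discrepancy is itself periodic in \<open>N\<close>, hence bounded.\<close>
  have bound: "\<bar>real (f N) - N * c\<bar> \<le> p" for N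
  proof (induction N rule: less_induct)
    case (less N)
    show ?case
    proof (cases "N < p")
      case True
      have "real (f N) \<le> N" using card_initial_le[of A N] by (simp add: f_def)
      moreover have "0 \<le> N * c" "N * c \<le> N" using c by (auto intro: mult_left_le)
      ultimately show ?thesis using True unfolding abs_le_iff by auto
    next
      case False
      then obtain N' where N': "N = N' + p" using le_Suc_ex[of p N] by (auto simp: add.commute)
      have "real (f N) - N * c = real (f N') - N' * c"
        using p by (simp add: N' step c_def field_simps)
      then show ?thesis using less[of N'] N' p by simp
    qed
  qed
  have "(\<lambda>N. ratio A N - c) \<longlonglongrightarrow> 0"
  proof (rule Lim_null_comparison)
    show "(\<lambda>N. real p / real N) \<longlonglongrightarrow> 0" by real_asymp
    show "eventually (\<lambda>N. norm (ratio A N - c) \<le> real p / real N) sequentially"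
      using eventually_gt_at_top[of 0]
    proof eventually_elim
      case (elim N)
      have "ratio A N - c = (real (f N) - N * c) / N" using elim by (simp add: f_def field_simps)
      then show ?case using bound[of N] by (simp add: divide_right_mono)
    qed
  qed
  then show ?thesis unfolding has_density_def c_def f_def by (simp add: LIM_zero_iff)
qed

section \<open>Sets of multiples\<close>

lemma in_multiples_of: "x \<in> multiples_of B \<longleftrightarrow> (\<exists>b\<in>B. b dvd x)"
  by (auto simp: multiples_of_def dvd_def)

lemma multiples_of_mono: "B \<subseteq> C \<Longrightarrow> multiples_of B \<subseteq> multiples_of C"
  by (auto simp: multiples_of_def)

lemma finite_head:
  assumes "B \<subseteq> pos_ints"
  shows "finite {b \<in> B. b \<le> k}"
  by (rule finite_subset[of _ "{1..k}"]) (use assms in \<open>auto simp: pos_ints_def\<close>)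

lemma multiples_of_split:
  "multiples_of B = multiples_of {b \<in> B. b \<le> k} \<union> multiples_of {b \<in> B. b > k}"
  by (force simp: in_multiples_of not_le)

lemma multiples_of_finite_period:
  assumes "finite C" "C \<subseteq> pos_ints"
  obtains p :: nat where "0 < p" "int p = \<Prod>C"
    "\<And>n k. n + int p * k \<in> multiples_of C \<longleftrightarrow> n \<in> multiples_of C"
proof -
  have pos: "0 < \<Prod>C" using assms by (intro prod_pos) (auto simp: pos_ints_def)
  have dvd: "c dvd \<Prod>C" if "c \<in> C" for c
    using that assms(1) by (metis dvd_prodI)
  show ?thesis
  proof (rule that[of "nat (\<Prod>C)"])
    show "n + int (nat (\<Prod>C)) * k \<in> multiples_of C \<longleftrightarrow> n \<in> multiples_of C" for n k
      using pos by (auto simp: in_multiples_of intro!: bex_cong simp: dvd dvd_add_left_iff)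
  qed (use pos in auto)
qed

section \<open>Multiples in arithmetic progressions\<close>

text \<open>Membership in \<open>multiples_of C\<close> depends only on the residue modulo \<open>p = \<Prod>C\<close>, and
  \<open>m \<mapsto> 1 + q m\<close> permutes these residues because \<open>q\<close> is coprime to \<open>p\<close>.\<close>

lemma upper_density_progression_finite:
  assumes C: "finite C" "C \<subseteq> pos_ints" and cop: "\<And>c. c \<in> C \<Longrightarrow> coprime c q"
  shows "upper_density {m. 1 + q * m \<in> multiples_of C} \<le> upper_density (multiples_of C)"
proof -
  obtain p :: nat where p: "0 < p" "int p = \<Prod>C"
    and per: "\<And>n k. n + int p * k \<in> multiples_of C \<longleftrightarrow> n \<in> multiples_of C"
    using multiples_of_finite_period[OF C] by blast
  have copp: "coprime (int p) q" unfolding p by (intro prod_coprime_left cop)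
  let ?A = "{m. 1 + q * m \<in> multiples_of C}"
  have "has_density (multiples_of C) (ratio (multiples_of C) p)"
    using per[of _ 1] by (intro has_density_periodic p) simp
  moreover have "has_density ?A (ratio ?A p)"

  proof (rule has_density_periodic[OF p(1)])
    have "1 + q * (n + int p) = (1 + q * n) + int p * q" for n by (simp add: algebra_simps)
    then show "n + int p \<in> ?A \<longleftrightarrow> n \<in> ?A" for n by (simp only: mem_Collect_eq per)
  qed
  moreover have "card (?A \<inter> {1..int p}) \<le> card (multiples_of C \<inter> {1..int p})"
  proof (rule card_inj_on_le)
    \<comment> \<open>\<open>q * m mod int p + 1\<close> is congruent to \<open>1 + q * m\<close> and lies in \<open>{1..int p}\<close>.\<close>
    show "inj_on (\<lambda>m. q * m mod int p + 1) (?A \<inter> {1..int p})"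
    proof (rule inj_onI)
      fix m m' assume m: "m \<in> ?A \<inter> {1..int p}" "m' \<in> ?A \<inter> {1..int p}"
        and eq: "q * m mod int p + 1 = q * m' mod int p + 1"
      from eq have "int p dvd q * (m - m')"
        by (simp add: mod_eq_dvd_iff right_diff_distrib)
      then have "int p dvd m - m'" using copp by (simp add: coprime_dvd_mult_right_iff)
      moreover have "\<bar>m - m'\<bar> < int p" using m by auto
      ultimately show "m = m'" using dvd_imp_le_int[of "m - m'" "int p"] by fastforce
    qed
    have "q * m mod int p + 1 \<in> multiples_of C" if "m \<in> ?A" for m
    proof -
      have "1 + q * m = (q * m mod int p + 1) + int p * (q * m div int p)" by simp
      then show ?thesis using per that by (metis mem_Collect_eq)
    qed
    then show "(\<lambda>m. q * m mod int p + 1) ` (?A \<inter> {1..int p}) \<subseteq> multiples_of C \<inter> {1..int p}"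
      using p(1) by (auto simp: add1_zle_eq)
  qed simp
  ultimately show ?thesis
    by (simp add: has_density_upper_density divide_right_mono)
qed

text \<open>For infinite \<open>C\<close>, the part beyond \<open>K\<close> is estimated crudely, at the cost of a factor \<open>q\<close>. Since \<open>q\<close>
  is fixed while \<open>K\<close> grows, light tails make that contribution vanish.\<close>

lemma upper_density_progression:
  assumes C: "C \<subseteq> pos_ints" "light_tails C" and q: "1 \<le> q"
    and cop: "\<And>c. c \<in> C \<Longrightarrow> coprime c q"
  shows "upper_density {m. 1 + q * m \<in> multiples_of C} \<le> upper_density (multiples_of C)"
proof -
  let ?A = "\<lambda>C. {m. 1 + q * m \<in> multiples_of C}"
  have bound: "upper_density (?A C) \<le> upper_density (multiples_of C)
    + ereal q * upper_density (multiples_of {c \<in> C. c > int K})" for K :: nat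
  proof -
    let ?H = "{c \<in> C. c \<le> int K}" and ?T = "{c \<in> C. c > int K}"
    have "?A C = ?A ?H \<union> ?A ?T" using multiples_of_split[of C "int K"] by auto
    then have "upper_density (?A C) \<le> upper_density (?A ?H) + upper_density (?A ?T)"
      using upper_density_Un[of "?A ?H" "?A ?T"] by (simp only:)
    also have "upper_density (?A ?H) \<le> upper_density (multiples_of ?H)"
      using C cop by (intro upper_density_progression_finite finite_head) auto
    also have "\<dots> \<le> upper_density (multiples_of C)"
      by (intro upper_density_mono le_infI1 multiples_of_mono) auto
    also have "upper_density (?A ?T) \<le> ereal q * upper_density (multiples_of ?T)"
      using q by (intro upper_density_affine[where r = 1]) (auto simp: add.commute)
    finally show ?thesis by (simp add: add_right_mono add_left_mono)
  qed
  have "(\<lambda>K. upper_density (multiples_of C)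
      + ereal q * upper_density (multiples_of {c \<in> C. c > int K}))
    \<longlonglongrightarrow> upper_density (multiples_of C) + ereal q * 0"
    using C(2) unfolding light_tails_def
    by (intro tendsto_add_ereal_general tendsto_cmult_ereal) auto
  then show ?thesis using bound by (auto intro: LIMSEQ_le_const)
qed

lemma light_tails_subset:
  assumes "light_tails B" "C \<subseteq> B"
  shows "light_tails C"
  unfolding light_tails_def
proof (rule tendsto_sandwich[OF _ _ tendsto_const])
  show "(\<lambda>K::nat. upper_density (multiples_of {b \<in> B. b > int K})) \<longlonglongrightarrow> 0"
    using assms by (simp add: light_tails_def)
qed (use assms(2) in \<open>auto intro!: always_eventually upper_density_nonneg upper_density_mono
    le_infI1 multiples_of_mono\<close>)

text \<open>The bound does not depend on \<open>q\<close>, which is what makes positivity work. It holds because the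
  moduli that actually matter, the reduced \<open>b div gcd b f\<close> dividing some \<open>1 + q * m\<close>, are coprime
  to \<open>q\<close>; and multiplication by \<open>f\<close> maps their multiples to multiples of \<open>B\<close>, so that both their
  density and their tails are controlled by those of \<open>B\<close>.\<close>

lemma upper_density_multiples_in_progression:
  assumes B: "B \<subseteq> pos_ints" "light_tails B" and f: "1 \<le> f" and q: "1 \<le> q"
  shows "upper_density {m. f * (1 + q * m) \<in> multiples_of B}
    \<le> ereal f * upper_density (multiples_of B)"
proof -
  define C where "C = {c \<in> (\<lambda>b. b div gcd b f) ` B. coprime c q}"
  have red: "b dvd f * x \<longleftrightarrow> b div gcd b f dvd x" for b x :: int
  proof -
    have g: "gcd b f \<noteq> 0" using f by auto
    have cop: "coprime (b div gcd b f) (f div gcd b f)"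
      using f by (intro div_gcd_coprime) auto
    have "b dvd f * x \<longleftrightarrow> gcd b f * (b div gcd b f) dvd gcd b f * ((f div gcd b f) * x)"
      by (simp flip: mult.assoc)
    also have "\<dots> \<longleftrightarrow> b div gcd b f dvd x"
      using g by (simp add: dvd_times_left_cancel_iff coprime_dvd_mult_right_iff[OF cop] del: dvd_mult_div_cancel gcd_eq_0_iff)
    finally show ?thesis .
  qed
  have C_pos: "C \<subseteq> pos_ints"
  proof
    fix c assume "c \<in> C"
    then obtain b where b: "b \<in> B" "c = b div gcd b f" by (auto simp: C_def)
    then have "c * gcd b f = b" "0 < b" using B by (auto simp: pos_ints_def)
    then have "0 < c" by (metis gcd_ge_0_int linorder_not_less mult_nonpos_nonneg)
    then show "c \<in> pos_ints" by (simp add: pos_ints_def)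
  qed
  have scale: "upper_density (multiples_of {c \<in> C. c > k})
      \<le> ereal f * upper_density (multiples_of {b \<in> B. b > k})" if "0 \<le> k" for k
  proof (rule upper_density_affine[OF f order_refl])
    fix x assume "x \<in> multiples_of {c \<in> C. c > k}"
    then obtain b where b: "b \<in> B" "b div gcd b f > k" "b div gcd b f dvd x"
      by (auto simp: in_multiples_of C_def)
    have "0 < b" using b B by (auto simp: pos_ints_def)
    then have "b div gcd b f \<le> b" using f
      by (smt (verit) gcd_pos_int zdiv_mono2 div_by_1)
    then show "f * x + 0 \<in> multiples_of {b \<in> B. b > k}"
      using b red by (auto simp: in_multiples_of)
  qed
  have "light_tails C" unfolding light_tails_def
  proof (rule tendsto_sandwich[OF _ _ tendsto_const])
    have "(\<lambda>K::nat. ereal f * upper_density (multiples_of {b \<in> B. b > int K})) \<longlonglongrightarrow> ereal f * 0"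
      using B(2) unfolding light_tails_def by (intro tendsto_cmult_ereal) auto
    then show "(\<lambda>K::nat. ereal f * upper_density (multiples_of {b \<in> B. b > int K})) \<longlonglongrightarrow> 0"
      by simp
  qed (auto intro!: always_eventually upper_density_nonneg scale)
  have "upper_density {m. f * (1 + q * m) \<in> multiples_of B}
    \<le> upper_density {m. 1 + q * m \<in> multiples_of C}"
  proof (intro upper_density_mono subsetI)
    fix m assume "m \<in> {m. f * (1 + q * m) \<in> multiples_of B} \<inter> pos_ints"
    then obtain b where b: "b \<in> B" "b div gcd b f dvd 1 + q * m"
      by (auto simp: in_multiples_of red)
    have "coprime (b div gcd b f) q"
    proof (rule coprimeI)
      fix d assume "d dvd b div gcd b f" "d dvd q"
      then have "d dvd 1 + q * m" "d dvd q * m" using b dvd_trans by auto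
      then show "is_unit d" using dvd_add_left_iff by blast
    qed
    then show "m \<in> {m. 1 + q * m \<in> multiples_of C}"
      using b by (auto simp: in_multiples_of C_def)
  qed
  also have "\<dots> \<le> upper_density (multiples_of C)"
    using C_pos \<open>light_tails C\<close> q by (rule upper_density_progression) (simp add: C_def)
  also have "\<dots> \<le> ereal f * upper_density (multiples_of B)"
  proof -
    have "{c \<in> C. c > 0} = C" "{b \<in> B. b > 0} = B"
      using C_pos B(1) by (auto simp: pos_ints_def)
    then show ?thesis using scale[of 0] by simp
  qed
  finally show ?thesis .
qed

section \<open>Existence of the density\<close>

lemma has_density_approx:
  assumes approx: "\<And>\<epsilon>. 0 < \<epsilon> \<Longrightarrow> \<exists>A' d. has_density A' d
      \<and> upper_density ((A - A') \<union> (A' - A)) < ereal \<epsilon>"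
  shows "\<exists>d. has_density A d"
proof -
  have "Cauchy (ratio A)"
  proof (rule metric_CauchyI)
    fix \<epsilon> :: real assume \<epsilon>: "0 < \<epsilon>"
    obtain A' d where A': "has_density A' d" "upper_density ((A - A') \<union> (A' - A)) < ereal (\<epsilon> / 4)"
      using approx[of "\<epsilon> / 4"] \<epsilon> by auto
    have close: "\<bar>ratio A N - ratio A' N\<bar> \<le> ratio ((A - A') \<union> (A' - A)) N" for N
    proof -
      have "ratio A N \<le> ratio A' N + ratio ((A - A') \<union> (A' - A)) N"
        by (rule order_trans[OF ratio_mono ratio_Un]) auto
      moreover have "ratio A' N \<le> ratio A N + ratio ((A - A') \<union> (A' - A)) N"
        by (rule order_trans[OF ratio_mono ratio_Un]) auto
      ultimately show ?thesis by linarith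
    qed
    have "eventually (\<lambda>N. dist (ratio A' N) d < \<epsilon> / 4) sequentially"
      using A'(1) \<epsilon> unfolding has_density_def by (intro tendstoD) auto
    moreover have "eventually (\<lambda>N. ratio ((A - A') \<union> (A' - A)) N < \<epsilon> / 4) sequentially"
      using A'(2) unfolding upper_density_def by (auto dest: Limsup_lessD)
    ultimately have "eventually (\<lambda>N. dist (ratio A N) d < \<epsilon> / 2) sequentially"
    proof eventually_elim
      case (elim N)
      then show ?case using close[of N] unfolding dist_real_def by linarith
    qed
    then obtain N0 where "\<And>N. N \<ge> N0 \<Longrightarrow> dist (ratio A N) d < \<epsilon> / 2"
      by (auto simp: eventually_sequentially)
    then show "\<exists>N0. \<forall>m\<ge>N0. \<forall>n\<ge>N0. dist (ratio A m) (ratio A n) < \<epsilon>"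
      by (meson dist_triangle_half_l)
  qed
  then show ?thesis
    unfolding has_density_def by (simp add: Cauchy_convergent_iff convergent_def)
qed

lemma has_density_pattern:
  assumes B: "B \<subseteq> pos_ints" "light_tails B"
    and "finite F" "finite M" "F \<subseteq> pos_ints" "M \<subseteq> pos_ints"
  shows "\<exists>d. has_density {n. translate F n \<subseteq> free_of B \<and> translate M n \<subseteq> multiples_of B} d"
proof -
  define S where "S B' = {n. translate F n \<subseteq> free_of B' \<and> translate M n \<subseteq> multiples_of B'}" for B'
  have S: "n \<in> S B' \<longleftrightarrow> (\<forall>f\<in>F. n + f \<notin> multiples_of B') \<and> (\<forall>m\<in>M. n + m \<in> multiples_of B')" for n B'
    by (auto simp: S_def translate_def free_of_def add.commute)
  have "\<exists>A' d. has_density A' d \<and> upper_density ((S B - A') \<union> (A' - S B)) < ereal \<epsilon>"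
    if \<epsilon>: "0 < \<epsilon>" for \<epsilon>
  proof -
    have "(\<lambda>K::nat. ereal (card (F \<union> M)) * upper_density (multiples_of {b \<in> B. b > int K}))
        \<longlonglongrightarrow> ereal (card (F \<union> M)) * 0"
      using B(2) unfolding light_tails_def by (intro tendsto_cmult_ereal) auto
    then have "eventually (\<lambda>K::nat. ereal (card (F \<union> M))
        * upper_density (multiples_of {b \<in> B. b > int K}) < ereal \<epsilon>) sequentially"
      using \<epsilon> by (intro order_tendstoD) auto
    then obtain K :: nat where K: "ereal (card (F \<union> M))
        * upper_density (multiples_of {b \<in> B. b > int K}) < ereal \<epsilon>"
      by (auto simp: eventually_sequentially)
    let ?H = "{b \<in> B. b \<le> int K}" and ?T = "{b \<in> B. b > int K}"
    obtain p :: nat where p: "0 < p"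
      "\<And>n k. n + int p * k \<in> multiples_of ?H \<longleftrightarrow> n \<in> multiples_of ?H"
      by (rule multiples_of_finite_period[of ?H]) (use B(1) finite_head[OF B(1)] in auto)
    have "has_density (S ?H) (ratio (S ?H) p)"
    proof (rule has_density_periodic[OF p(1)])
      have "n + int p + h \<in> multiples_of ?H \<longleftrightarrow> n + h \<in> multiples_of ?H" for n h
        using p(2)[of "n + h" 1] by (simp add: algebra_simps)
      then show "n + int p \<in> S ?H \<longleftrightarrow> n \<in> S ?H" for n
        unfolding S by simp
    qed
    moreover have "upper_density ((S B - S ?H) \<union> (S ?H - S B)) < ereal \<epsilon>"
    proof -
      have "(S B - S ?H) \<union> (S ?H - S B) \<subseteq> (\<Union>h\<in>F \<union> M. {n. n + h \<in> multiples_of ?T})"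
      proof
        fix n assume n: "n \<in> (S B - S ?H) \<union> (S ?H - S B)"
        show "n \<in> (\<Union>h\<in>F \<union> M. {n. n + h \<in> multiples_of ?T})"
        proof (rule ccontr)
          assume "n \<notin> (\<Union>h\<in>F \<union> M. {n. n + h \<in> multiples_of ?T})"
          then have "n + h \<in> multiples_of B \<longleftrightarrow> n + h \<in> multiples_of ?H" if "h \<in> F \<union> M" for h
            using that multiples_of_split[of B "int K"] by blast
          then have "n \<in> S B \<longleftrightarrow> n \<in> S ?H" by (simp add: S)
          then show False using n by blast
        qed
      qed
      then have "upper_density ((S B - S ?H) \<union> (S ?H - S B))
          \<le> upper_density (\<Union>h\<in>F \<union> M. {n. n + h \<in> multiples_of ?T})"
        by (intro upper_density_mono) auto
      also have "\<dots> \<le> (\<Sum>h\<in>F \<union> M. upper_density {n. n + h \<in> multiples_of ?T})"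
        using assms by (intro upper_density_UN) auto
      also have "\<dots> \<le> (\<Sum>h\<in>F \<union> M. upper_density (multiples_of ?T))"
      proof (rule sum_mono)
        fix h assume "h \<in> F \<union> M"
        then have "0 \<le> h" using assms by (auto simp: pos_ints_def)
        then have "upper_density {n. n + h \<in> multiples_of ?T}
            \<le> ereal (real_of_int 1) * upper_density (multiples_of ?T)"
          by (intro upper_density_affine) auto
        then show "upper_density {n. n + h \<in> multiples_of ?T} \<le> upper_density (multiples_of ?T)"
          by (simp flip: one_ereal_def)
      qed
      also have "\<dots> = ereal (card (F \<union> M)) * upper_density (multiples_of ?T)"
      proof -
        obtain u where "upper_density (multiples_of ?T) = ereal u" by (rule upper_density_real)
        then show ?thesis by simp
      qed
      finally show ?thesis using K by simp
    qed
    ultimately show ?thesis by blast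
  qed
  from has_density_approx[OF this] show ?thesis unfolding S_def .
qed

section \<open>Positivity of the density\<close>

text \<open>Multiplication by \<open>L\<close> maps the set \<open>G\<close> of those \<open>m\<close> that the tail does not spoil into the pattern
  set. As \<open>G\<close> has upper density above \<open>1/2\<close>, the pattern set has upper density at least
  \<open>1 / (2 * L)\<close>.\<close>

lemma upper_density_pattern_pos:
  assumes B: "B \<subseteq> pos_ints" "light_tails B"
    and F: "F \<subseteq> pos_ints" "finite F" "F \<subseteq> free_of B"
    and M: "M \<subseteq> pos_ints" "finite M" "M \<subseteq> multiples_of B"
  shows "0 < upper_density {n. translate F n \<subseteq> free_of B \<and> translate M n \<subseteq> multiples_of B}"
    (is "0 < upper_density ?S")
proof -
  define T where "T K = {b \<in> B. b > int K}" for K :: nat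
  have "(\<lambda>K. ereal (real_of_int (\<Sum>F)) * upper_density (multiples_of (T K)))
      \<longlonglongrightarrow> ereal (real_of_int (\<Sum>F)) * 0"
    using B(2) unfolding light_tails_def T_def by (intro tendsto_cmult_ereal) auto
  then have "eventually (\<lambda>K. ereal (real_of_int (\<Sum>F)) * upper_density (multiples_of (T K))
      < ereal (1/2)) sequentially"
    by (intro order_tendstoD) auto
  then obtain K1 where K1: "\<And>K. K \<ge> K1 \<Longrightarrow>
      ereal (real_of_int (\<Sum>F)) * upper_density (multiples_of (T K)) < ereal (1/2)"
    unfolding eventually_sequentially by blast
  obtain k where k: "\<And>m. m \<in> M \<Longrightarrow> m \<le> k"
    using M(2) Max_ge by blast
  define K where "K = max K1 (nat k)"
  have T: "ereal (real_of_int (\<Sum>F)) * upper_density (multiples_of (T K)) < ereal (1/2)"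
    using K1 by (simp add: K_def)
  define H where "H = {b \<in> B. b \<le> int K}"
  have H: "finite H" "H \<subseteq> pos_ints" using B finite_head by (auto simp: H_def)
  define q where "q f = \<Prod>(F - {f}) * \<Prod>H" for f
  define L where "L = \<Prod>F * \<Prod>H"
  have q: "1 \<le> q f" for f
  proof -
    have "0 < \<Prod>(F - {f})" "0 < \<Prod>H"
      using F(1) H(2) by (auto intro!: prod_pos simp: pos_ints_def)
    then have "0 < q f" unfolding q_def by (rule mult_pos_pos)
    then show ?thesis by simp
  qed
  have L: "1 \<le> L"
  proof -
    have "0 < \<Prod>F" "0 < \<Prod>H"
      using F(1) H(2) by (auto intro!: prod_pos simp: pos_ints_def)
    then have "0 < L" unfolding L_def by (rule mult_pos_pos)
    then show ?thesis by simp
  qed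
  have Lq: "L = f * q f" if "f \<in> F" for f
    using F(2) that by (simp add: L_def q_def prod.remove)
  have HL: "b dvd L" if "b \<in> H" for b
  proof -
    have "b dvd \<Prod>H" using H(1) that by (metis dvd_prodI)
    then show ?thesis by (simp add: L_def)
  qed
  define Bad where "Bad f = {m. f * (1 + q f * m) \<in> multiples_of (T K)}" for f
  have "upper_density (\<Union>f\<in>F. Bad f) \<le> (\<Sum>f\<in>F. upper_density (Bad f))"
    using F(2) by (rule upper_density_UN)
  also have "\<dots> \<le> (\<Sum>f\<in>F. ereal (real_of_int f) * upper_density (multiples_of (T K)))"
  proof (rule sum_mono)
    fix f assume f: "f \<in> F"
    have "T K \<subseteq> B" by (auto simp: T_def)
    then show "upper_density (Bad f) \<le> ereal (real_of_int f) * upper_density (multiples_of (T K))"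
      unfolding Bad_def using B light_tails_subset F(1) f q
      by (intro upper_density_multiples_in_progression) (auto simp: pos_ints_def)
  qed
  also have "\<dots> = ereal (real_of_int (\<Sum>F)) * upper_density (multiples_of (T K))"
  proof -
    obtain u where "upper_density (multiples_of (T K)) = ereal u" by (rule upper_density_real)
    then show ?thesis by (simp add: sum_distrib_right)
  qed
  finally have bad: "upper_density (\<Union>f\<in>F. Bad f) < ereal (1/2)" using T by simp
  define G where "G = - (\<Union>f\<in>F. Bad f)"
  have "upper_density G \<le> ereal L * upper_density ?S"
  proof (rule upper_density_affine[OF L order_refl])
    fix m assume m: "m \<in> G"
    have "f + L * m \<notin> multiples_of B" if f: "f \<in> F" for f
    proof
      assume "f + L * m \<in> multiples_of B"
      then obtain b where b: "b \<in> B" "b dvd f + L * m" by (auto simp: in_multiples_of)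
      have "\<not> b dvd f" using b f F(3) by (auto simp: free_of_def in_multiples_of)
      then have "b \<notin> H" using b(2) HL by (metis dvd_add_left_iff dvd_mult2)
      then have "b \<in> T K" using b by (auto simp: H_def T_def)
      moreover have "f + L * m = f * (1 + q f * m)" using Lq[OF f] by (simp add: algebra_simps)
      ultimately have "m \<in> Bad f" using b by (auto simp: Bad_def in_multiples_of)
      then show False using m f by (auto simp: G_def)
    qed
    moreover have "a + L * m \<in> multiples_of B" if a: "a \<in> M" for a
    proof -
      obtain b where b: "b \<in> B" "b dvd a" using a M(3) in_multiples_of by blast
      have "0 < a" using a M(1) by (auto simp: pos_ints_def)
      then have "b \<le> int K" using b k[OF a] zdvd_imp_le[of b a] by (auto simp: K_def)
      then have "b dvd L" using b HL by (simp add: H_def)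
      then have "b dvd a + L * m" using b by (intro dvd_add dvd_mult2)
      then show ?thesis using b in_multiples_of by blast
    qed
    ultimately show "L * m + 0 \<in> ?S" by (auto simp: translate_def free_of_def)
  qed
  moreover have "ereal (1/2) < upper_density G"
  proof -
    have "has_density UNIV (ratio UNIV 1)" using has_density_periodic[of 1 UNIV] by simp
    then have "1 = upper_density UNIV" using has_density_upper_density by (fastforce simp: one_ereal_def)
    also have "\<dots> \<le> upper_density G + upper_density (\<Union>f\<in>F. Bad f)"
      using upper_density_Un[of G "\<Union>f\<in>F. Bad f"] unfolding G_def Compl_partition2 .
    finally show ?thesis
      using bad by (cases "upper_density G"; cases "upper_density (\<Union>f\<in>F. Bad f)") (auto simp: one_ereal_def)
  qed
  ultimately show ?thesis
    using upper_density_nonneg[of ?S]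
    by (cases "upper_density ?S = 0") (auto dest: less_le_trans simp: zero_ereal_def)
qed

theorem corollary1p12:
  fixes B F M :: "int set"
  assumes "B \<subseteq> pos_ints" and "light_tails B"
    and "F \<subseteq> pos_ints" and "finite F" and "F \<subseteq> free_of B"
    and "M \<subseteq> pos_ints" and "finite M" and "M \<subseteq> multiples_of B"
  shows "\<exists>d>0. has_density
           {n \<in> pos_ints. translate F n \<subseteq> free_of B \<and> translate M n \<subseteq> multiples_of B} d"
proof -
  let ?S = "{n. translate F n \<subseteq> free_of B \<and> translate M n \<subseteq> multiples_of B}"
  obtain d where d: "has_density ?S d"
    using has_density_pattern[of B F M] assms by blast
  have "0 < d"
    using upper_density_pattern_pos[of B F M] assms has_density_upper_density[OF d] by simp
  moreover have "{n \<in> pos_ints. translate F n \<subseteq> free_of B \<and> translate M n \<subseteq> multiples_of B}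
      \<inter> {1..int N} = ?S \<inter> {1..int N}" for N
    by (auto simp: pos_ints_def)
  ultimately show ?thesis using d by (auto simp: has_density_def)
qed

end
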